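(* Let $\boldsymbol{\beta}=(\beta_1,\dots,\beta_p)$ be an alternate base and set $\delta=\prod_{i=1}^p\beta_i$. If every rational number in $[0,1)$ has an eventually periodic $\boldsymbol{\beta}$-expansion (i.e. $\mathbb{Q}\cap[0,1)\subseteq \mathrm{Per}(\boldsymbol{\beta})$), then $\delta$ is either a Pisot number or a Salem number, and $\beta_1,\dots,\beta_p\in\mathbb{Q}(\delta)$.
   Context: An alternate base is a $p$-tuple $\boldsymbol{\beta}=(\beta_1,\dots,\beta_p)$ of real numbers $\beta_i>1$ ($p\ge 1$), identified with the purely periodic sequence $(\beta_k)_{k\ge1}$ with $\beta_{k+p}=\beta_k$. For $x\in[0,1)$ the $\boldsymbol{\beta}$-expansion $d_{\boldsymbol{\beta}}(x)=a_1a_2a_3\cdots$ is given by the greedy algorithm: $r_0=x$ and for $k\ge0$, $a_{k+1}=\lfloor \beta_{k+1}r_k\rfloor$, $r_{k+1}=\beta_{k+1}r_k-a_{k+1}$; then $x=\sum_{k\ge1} a_k/\prod_{i=1}^k\beta_i$. $\mathrm{Per}(\boldsymbol{\beta})$ denotes the set of $x\in[0,1)$ whose $\boldsymbol{\beta}$-expansion is eventually periodic. A Pisot number is a real algebraic integer $>1$ all of whose other conjugates have modulus $<1$; a Salem number is a real algebraic integer $>1$ all of whose other conjugates have modulus $\le1$, at least one having modulus exactly $1$. *)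

theory Defs
  imports "HOL-Computational_Algebra.Computational_Algebra"
begin

definition alt_base :: "real list \<Rightarrow> bool" where
  "alt_base bs \<longleftrightarrow> bs \<noteq> [] \<and> (\<forall>b\<in>set bs. b > 1)"

definition abase :: "real list \<Rightarrow> nat \<Rightarrow> real" where
  "abase bs k = bs ! (k mod length bs)"   \<comment> \<open>abase bs k = beta_(k+1)\<close>

fun greedy_rem :: "real list \<Rightarrow> real \<Rightarrow> nat \<Rightarrow> real" where
  "greedy_rem bs x 0 = x"
| "greedy_rem bs x (Suc k) =
     abase bs k * greedy_rem bs x k - of_int \<lfloor>abase bs k * greedy_rem bs x k\<rfloor>"

text \<open>Digits: greedy_digit bs x k = a_(k+1) = floor(beta_(k+1) r_k).\<close>
definition greedy_digit :: "real list \<Rightarrow> real \<Rightarrow> nat \<Rightarrow> int" where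
  "greedy_digit bs x k = \<lfloor>abase bs k * greedy_rem bs x k\<rfloor>"

definition eventually_periodic :: "(nat \<Rightarrow> 'a) \<Rightarrow> bool" where
  "eventually_periodic a \<longleftrightarrow> (\<exists>N q. q > 0 \<and> (\<forall>n\<ge>N. a (n + q) = a n))"

definition Per :: "real list \<Rightarrow> real set" where
  "Per bs = {x. 0 \<le> x \<and> x < 1 \<and> eventually_periodic (greedy_digit bs x)}"

text \<open>Minimal polynomial of an algebraic integer: monic irreducible integer polynomial
  (by Gauss's lemma this is the minimal polynomial over Q). Conjugates are its other
  complex roots.\<close>
definition pisot :: "real \<Rightarrow> bool" where
  "pisot d \<longleftrightarrow> d > 1 \<and> (\<exists>P :: int poly. lead_coeff P = 1 \<and> irreducible P \<and>
      poly (map_poly of_int P) (complex_of_real d) = 0 \<and>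
      (\<forall>z. poly (map_poly of_int P) z = 0 \<and> z \<noteq> complex_of_real d \<longrightarrow> cmod z < 1))"

definition salem :: "real \<Rightarrow> bool" where
  "salem d \<longleftrightarrow> d > 1 \<and> (\<exists>P :: int poly. lead_coeff P = 1 \<and> irreducible P \<and>
      poly (map_poly of_int P) (complex_of_real d) = 0 \<and>
      (\<forall>z. poly (map_poly of_int P) z = 0 \<and> z \<noteq> complex_of_real d \<longrightarrow> cmod z \<le> 1) \<and>
      (\<exists>z. poly (map_poly of_int P) z = 0 \<and> z \<noteq> complex_of_real d \<and> cmod z = 1))"

definition in_Q_adjoin :: "real \<Rightarrow> real \<Rightarrow> bool" where
  "in_Q_adjoin d y \<longleftrightarrow> (\<exists>P Q :: rat poly. poly (map_poly of_rat Q) d \<noteq> 0 \<and>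
      y = poly (map_poly of_rat P) d / poly (map_poly of_rat Q) d)"

end

theory Submission
  imports Defs "Jordan_Normal_Form.Char_Poly"
begin

text \<open>
  Write \<open>p\<close> for the period and \<open>\<gamma>\<^sub>j\<close> for the product of the bases strictly after position \<open>j\<close>. Grouping
  digits into blocks of length \<open>p\<close>, the expansion of a rational \<open>x\<close> reads
  \<open>x = \<Sum>j. \<gamma>\<^sub>j * S\<^sub>j(\<delta>)\<close>, where \<open>S\<^sub>j(w) = \<Sum>n. a(n p + j) / w^(n+1)\<close> is, by periodicity, a rational
  function of \<open>w\<close> over the integers with poles only in the closed unit disc.

  Rationals just above the reciprocals of \<open>\<beta>\<^sub>1\<cdots>\<beta>\<^sub>i\<close> have expansions that start with a single digit 1
  followed by many zeros; for them these relations form a strictly diagonally dominant linear system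
  in the \<open>\<gamma>\<^sub>j\<close>, so Cramer's rule puts the \<open>\<gamma>\<^sub>j\<close> and hence the bases into \<open>\<rat>(\<delta>)\<close>.

  Applying an embedding \<open>\<delta> \<mapsto> z\<close> with \<open>|z| > 1\<close> to the relations and letting \<open>x\<close> tend to \<open>1/\<delta>\<close> through
  such rationals gives \<open>1/z = 1/\<delta>\<close>. So no conjugate other than \<open>\<delta>\<close> lies outside the unit disc, and
  \<open>\<delta>\<close> is algebraic, since a transcendental \<open>\<delta>\<close> could be sent to almost any \<open>z\<close>.

  Integrality is the same argument at a non-archimedean place: \<open>x = 1/b\<close> with large \<open>b\<close> has many leading
  zero blocks, so a fixed non-zero integer is divisible by arbitrarily high powers of \<open>1/\<delta>\<close> up to a
  factor \<open>1 - \<delta>^(-q)\<close>, which is impossible if a prime divides the leading coefficient of the minimal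
  polynomial of \<open>\<delta>\<close>.
\<close>

hide_const (open) Module.smult
unbundle no Formal_Power_Series.fps_syntax

section \<open>Integer polynomials\<close>

text \<open>Relations are kept as integer polynomials and evaluated last, so that an identity found
  at \<delta> can be re-evaluated at another point \<open>z\<close>.\<close>

definition int_eval :: "complex \<Rightarrow> int poly \<Rightarrow> complex" where
  "int_eval z f = poly (map_poly of_int f) z"

interpretation int_eval: comm_ring_hom "int_eval z" for z
  by unfold_locales (simp_all add: int_eval_def hom_distribs)

lemma int_eval_monom [simp]: "int_eval z (monom c n) = of_int c * z ^ n"
  by (simp add: int_eval_def poly_monom)

lemma int_eval_const [simp]: "int_eval z [:c:] = of_int c"
  by (simp add: int_eval_def hom_distribs)

lemma int_eval_smult [simp]: "int_eval z (smult c f) = of_int c * int_eval z f"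
  by (simp add: int_eval_def hom_distribs)

text \<open>Pseudo-division replaces division over the rationals: every member of \<open>I\<close>,
  times a nonzero integer, is a multiple of a nonzero member \<open>M\<close> of least degree. In
  \<open>smult a P = M * q\<close> the prime \<open>P\<close> then divides \<open>M\<close> or
  \<open>q\<close>. It is applied to the vanishing ideal of \<delta> and to the ideal generated by
  its minimal polynomial and a denominator.\<close>

lemma ideal_of_int_poly_irreducible:
  fixes P :: "int poly" and I :: "int poly set"
  assumes irr: "irreducible P" and PI: "P \<in> I"
    and closed: "\<And>f g q a. f \<in> I \<Longrightarrow> g \<in> I \<Longrightarrow> smult a f - g * q \<in> I"
  shows "(\<forall>f\<in>I. P dvd f) \<or> (\<exists>c. c \<noteq> 0 \<and> [:c:] \<in> I)"
proof -
  have P0: "P \<noteq> 0" using irr by auto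
  have prime: "prime_elem P" using irr by (rule irreducible_imp_prime_elem)
  obtain M where M: "M \<in> I" "M \<noteq> 0"
    and min: "\<And>f. f \<in> I \<Longrightarrow> f \<noteq> 0 \<Longrightarrow> degree M \<le> degree f"
    using ex_has_least_nat[of "\<lambda>f. f \<in> I \<and> f \<noteq> 0" P degree] PI P0 by auto
  have div: "\<exists>a q. a \<noteq> 0 \<and> smult a f = M * q" if f: "f \<in> I" for f
  proof -
    obtain a q where aq: "a \<noteq> 0" "smult a f = M * q + pseudo_mod f M"
      using pseudo_mod(1)[OF M(2)] by blast
    then have "pseudo_mod f M = smult a f - M * q" by simp
    then have "pseudo_mod f M \<in> I" using closed[OF f M(1)] by simp
    then have "pseudo_mod f M = 0"
      using min pseudo_mod(2)[OF M(2), of f] by force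
    then show ?thesis using aq by auto
  qed
  obtain a q where aq: "a \<noteq> 0" "smult a P = M * q" using div[OF PI] by blast
  have "P dvd M * q" unfolding aq(2)[symmetric] by (simp add: dvd_smult)
  then consider "P dvd M" | "P dvd q" using prime by (auto simp: prime_elem_dvd_mult_iff)
  then show ?thesis
  proof cases
    case 1
    show ?thesis
    proof (cases "\<forall>f\<in>I. P dvd f")
      case False
      then obtain f where f: "f \<in> I" "\<not> P dvd f" by blast
      obtain b r where br: "b \<noteq> 0" "smult b f = M * r" using div[OF f(1)] by blast
      \<comment> \<open>If \<open>f\<close> is no multiple of \<open>P\<close>, primality moves
        \<open>P\<close> into the integer \<open>b\<close>, so \<open>P\<close> itself is the
        required constant.\<close>
      have "P dvd [:b:] * f" using 1 br(2) by simp
      then have "P dvd [:b:]" using f prime by (simp only: prime_elem_dvd_mult_iff simp_thms)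
      then have "degree P = 0" using br(1) dvd_imp_degree_le[of P "[:b:]"] by simp
      then obtain c where "P = [:c:]" by (rule degree_eq_zeroE)
      then show ?thesis using PI P0 by auto
    qed simp
  next
    case 2
    then obtain q' where "q = P * q'" by blast
    \<comment> \<open>Cancelling \<open>P\<close> leaves \<open>M\<close> as a divisor of a nonzero
      integer, so \<open>M\<close> is the required constant.\<close>
    with aq have "P * [:a:] = P * (M * q')" by (simp add: mult_ac)
    then have "[:a:] = M * q'" using P0 by (simp only: mult_cancel_left simp_thms)
    then have "M dvd [:a:]" by simp
    then have "degree M = 0"
      using aq(1) dvd_imp_degree_le[of M "[:a:]"] by simp
    then obtain c where "M = [:c:]" by (rule degree_eq_zeroE)
    then show ?thesis using M by auto
  qed
qed

text \<open>Gauss's argument on truncated products. In coefficient \<open>j + s\<close> of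
  \<open>P * h\<close>, terms with \<open>i < s\<close> get one factor \<open>l\<close> from
  \<open>P\<close> and \<open>l ^ v\<close> from \<open>h\<close>, while terms with
  \<open>i > s\<close> involve earlier coefficients of \<open>h\<close>. Each further power of
  \<open>l\<close> costs \<open>s\<close> indices of the window below \<open>n\<close>.\<close>

lemma prime_power_dvd_cofactor:
  fixes P h :: "int poly"
  assumes l: "prime l" and s: "\<not> l dvd coeff P s" "\<And>i. i < s \<Longrightarrow> l dvd coeff P i"
    and "\<And>k. k < n \<Longrightarrow> l ^ v dvd coeff (P * h) k" and "j + v * s < n"
  shows "l ^ v dvd coeff h j"
  using assms(4,5)
proof (induction v arbitrary: j)
  case (Suc v)
  have IH: "l ^ v dvd coeff h j" if "j + v * s < n" for j
    using Suc.IH[of j] Suc.prems(1) that by (meson dvd_trans le_imp_power_dvd le_SucI le_refl)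
  show ?case using Suc.prems(2)
  proof (induction j rule: less_induct)
    case (less j)
    have "l ^ Suc v dvd coeff P i * coeff h (j + s - i)" if "i \<in> {..j + s} - {s}" for i
    proof (cases "i < s")
      case True
      then have "l ^ v dvd coeff h (j + s - i)" using less.prems by (intro IH) simp
      then show ?thesis using s(2)[OF True] by (simp add: mult_dvd_mono)
    next
      case False
      then have "l ^ Suc v dvd coeff h (j + s - i)"
        using that less.prems by (intro less.IH) auto
      then show ?thesis by (rule dvd_mult)
    qed
    then have rest: "l ^ Suc v dvd (\<Sum>i\<in>{..j + s} - {s}. coeff P i * coeff h (j + s - i))"
      by (rule dvd_sum)
    have split: "coeff (P * h) (j + s) = coeff P s * coeff h j
        + (\<Sum>i\<in>{..j + s} - {s}. coeff P i * coeff h (j + s - i))"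
      unfolding coeff_mult by (subst sum.remove[of _ s]) auto
    have "l ^ Suc v dvd coeff (P * h) (j + s)"
      using less.prems by (intro Suc.prems(1)) simp
    then have "l ^ Suc v dvd coeff P s * coeff h j"
      unfolding split dvd_add_left_iff[OF rest] .
    moreover have "coprime (l ^ Suc v) (coeff P s)"
      using l s(1) by (simp add: prime_imp_coprime)
    ultimately show ?case by (simp add: coprime_dvd_mult_right_iff)
  qed
qed simp

text \<open>A prime \<open>l\<close> dividing the leading coefficient of \<open>P\<close> would
  divide \<open>r = lead_coeff P * lead_coeff h\<close> once more than its multiplicity in
  \<open>r\<close> allows, because the top coefficients of \<open>F = P * h\<close> already force
  the full \<open>l\<close>-part of \<open>r\<close> into \<open>lead_coeff h\<close>.\<close>

lemma irreducible_lead_coeff_unit: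
  fixes P :: "int poly"
  assumes irr: "irreducible P" and deg: "degree P > 0" and r: "r \<noteq> 0"
    and mult: "\<And>n. \<exists>F. P dvd F \<and> lead_coeff F = r \<and> (\<forall>k<n. r dvd coeff (reflect_poly F) k)"
  shows "\<bar>lead_coeff P\<bar> = 1"
proof (rule ccontr)
  assume "\<bar>lead_coeff P\<bar> \<noteq> 1"
  then obtain l where l: "prime l" "l dvd lead_coeff P"
    using prime_divisor_exists[of "lead_coeff P"] deg by force
  \<comment> \<open>An irreducible polynomial of positive degree is primitive, so \<open>l\<close>
    cannot divide all its coefficients.\<close>
  have "\<exists>s. \<not> l dvd coeff (reflect_poly P) s"
  proof (rule ccontr)
    assume "\<nexists>s. \<not> l dvd coeff (reflect_poly P) s"
    then have *: "l dvd coeff (reflect_poly P) s" for s by blast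
    have "l dvd coeff P i" for i
      using *[of "degree P - i"]
      by (cases "i \<le> degree P") (auto simp: coeff_reflect_poly coeff_eq_0 split: if_splits)
    then have "[:l:] dvd P" by (simp add: const_poly_dvd_iff)
    then obtain Q where Q: "P = [:l:] * Q" by blast
    then have "is_unit [:l:] \<or> is_unit Q" by (rule irreducibleD[OF irr])
    moreover have "\<not> is_unit [:l:]" 
      using l(1) not_prime_unit[of l] is_unit_const_poly_iff[of l] by blast
    moreover have "degree P \<le> degree Q" unfolding Q by (simp add: degree_smult_le)
    then have "degree Q \<noteq> 0" using deg by linarith
    then have "\<not> is_unit Q" by (auto simp: is_unit_poly_iff)
    ultimately show False by blast
  qed
  then obtain s where s: "\<not> l dvd coeff (reflect_poly P) s"
      "\<And>i. i < s \<Longrightarrow> l dvd coeff (reflect_poly P) i"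
    using exists_least_iff[of "\<lambda>s. \<not> l dvd coeff (reflect_poly P) s"] by blast
  define v where "v = multiplicity l r"
  have v: "l ^ v dvd r" by (simp add: v_def multiplicity_dvd)
  \<comment> \<open>A window of length \<open>v * s + 1\<close> is just enough to reach index
    \<open>0\<close> of the reflected cofactor, which is \<open>lead_coeff h\<close>.\<close>
  obtain F h where F: "F = P * h" "lead_coeff F = r" "\<forall>k<Suc (v * s). r dvd coeff (reflect_poly F) k"
    using mult[of "Suc (v * s)"] by blast
  have low: "l ^ v dvd coeff (reflect_poly P * reflect_poly h) k" if "k < Suc (v * s)" for k
    using v F(3) that by (metis F(1) dvd_trans reflect_poly_mult)
  have "l ^ v dvd coeff (reflect_poly h) 0"
    by (rule prime_power_dvd_cofactor[OF l(1) s low]) auto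
  then have "l * l ^ v dvd lead_coeff P * lead_coeff h"
    using l(2) by (intro mult_dvd_mono) auto
  then have "l ^ Suc v dvd r" using F by (simp add: lead_coeff_mult)
  then have "Suc v \<le> multiplicity l r"
    using not_prime_unit[of l] l(1) by (intro multiplicity_geI[OF r]) auto
  then show False by (simp add: v_def)
qed

section \<open>Linear systems and power series\<close>

text \<open>Levy-Desplanques: in a kernel vector, the row of an entry of largest modulus contradicts
  dominance.\<close>

lemma strictly_diagonally_dominant_det_nonzero:
  fixes A :: "complex mat"
  assumes A: "A \<in> carrier_mat n n"
    and dom: "\<And>i. i < n \<Longrightarrow> (\<Sum>j\<in>{..<n} - {i}. cmod (A $$ (i, j))) < cmod (A $$ (i, i))"
  shows "det A \<noteq> 0"
proof
  assume "det A = 0"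
  then obtain v where v: "v \<in> carrier_vec n" "v \<noteq> 0\<^sub>v n" "A *\<^sub>v v = 0\<^sub>v n"
    using det_0_iff_vec_prod_zero_field[OF A] by blast
  then obtain k where k: "k < n" "v $ k \<noteq> 0" by (metis eq_vecI carrier_vecD index_zero_vec)
  have "Max ((\<lambda>i. cmod (v $ i)) ` {..<n}) \<in> (\<lambda>i. cmod (v $ i)) ` {..<n}"
    using k(1) by (intro Max_in) auto
  then obtain i where i: "i < n" and "cmod (v $ i) = Max ((\<lambda>i. cmod (v $ i)) ` {..<n})"
    by force
  then have max: "\<And>j. j < n \<Longrightarrow> cmod (v $ j) \<le> cmod (v $ i)" by simp
  have vi: "cmod (v $ i) > 0" using max[OF k(1)] k(2) by (smt (verit) zero_less_norm_iff)
  have "(A *\<^sub>v v) $ i = (\<Sum>j<n. A $$ (i, j) * v $ j)"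
    using A v(1) i by (auto simp: scalar_prod_def lessThan_atLeast0 intro!: sum.cong)
  also have "\<dots> = A $$ (i, i) * v $ i + (\<Sum>j\<in>{..<n} - {i}. A $$ (i, j) * v $ j)"
    using i by (subst sum.remove[of _ i]) auto
  finally have "A $$ (i, i) * v $ i = - (\<Sum>j\<in>{..<n} - {i}. A $$ (i, j) * v $ j)"
    using v(3) i by (simp add: add_eq_0_iff2)
  then have "cmod (A $$ (i, i)) * cmod (v $ i) = cmod (\<Sum>j\<in>{..<n} - {i}. A $$ (i, j) * v $ j)"
    by (metis norm_minus_cancel norm_mult)
  also have "\<dots> \<le> (\<Sum>j\<in>{..<n} - {i}. cmod (A $$ (i, j)) * cmod (v $ i))"
    using max by (intro order_trans[OF norm_sum] sum_mono) (simp add: norm_mult mult_left_mono)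
  also have "\<dots> < cmod (A $$ (i, i)) * cmod (v $ i)"
    using dom[OF i] vi by (simp add: sum_distrib_right[symmetric])
  finally show False by simp
qed

text \<open>The determinants are formed before evaluation, so the solutions become quotients of
  values of integer polynomials.\<close>

lemma cramer_int_poly:
  fixes M :: "int poly mat" and rhs :: "int poly vec" and y :: "nat \<Rightarrow> complex"
  assumes M: "M \<in> carrier_mat n n" and rhs: "rhs \<in> carrier_vec n"
    and eqs: "\<And>i. i < n \<Longrightarrow> (\<Sum>j<n. int_eval z (M $$ (i, j)) * y j) = int_eval z (rhs $ i)"
    and k: "k < n"
  shows "int_eval z (det (replace_col M rhs k)) = y k * int_eval z (det M)"
proof -
  define A where "A = map_mat (int_eval z) M"
  have A: "A \<in> carrier_mat n n" using M by (simp add: A_def)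
  have "A *\<^sub>v vec n y = map_vec (int_eval z) rhs"
    using eqs M rhs
    by (intro eq_vecI) (auto simp: A_def scalar_prod_def lessThan_atLeast0 intro!: sum.cong)
  then have "replace_col A (A *\<^sub>v vec n y) k = map_mat (int_eval z) (replace_col M rhs k)"
    using M rhs by (intro eq_matI) (auto simp: replace_col_def A_def)
  then have "int_eval z (det (replace_col M rhs k)) = det (replace_col A (A *\<^sub>v vec n y) k)"
    by simp
  also have "\<dots> = vec n y $ k * det A" using A k by (intro cramer_lemma_mat) auto
  finally show ?thesis using k by (simp add: A_def)
qed

text \<open>Multiplying by \<open>w ^ q - 1\<close> cancels the periodic tail and
  \<open>w ^ m\<close> clears the remaining denominators. The polynomial \<open>B\<close> is the
  same for all \<open>w\<close>, and leading zero coefficients lower its degree.\<close>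

lemma eventually_periodic_series:
  fixes c :: "nat \<Rightarrow> int"
  assumes sum: "\<And>w::complex. cmod w > 1 \<Longrightarrow> (\<lambda>n. of_int (c n) / w ^ Suc n) sums S w"
    and per: "\<And>n. n \<ge> m \<Longrightarrow> c (n + q) = c n"
    and zero: "\<And>n. n < n0 \<Longrightarrow> c n = 0" and q: "q \<ge> n0"
  obtains B where "degree B \<le> m + q - 1 - n0"
    "\<And>w. cmod w > 1 \<Longrightarrow> S w * (w ^ m * (w ^ q - 1)) = int_eval w B"
proof
  let ?B = "(\<Sum>n<q. monom (c n) (m + q - 1 - n)) + (\<Sum>n<m. monom (c (n + q) - c n) (m - 1 - n))"
  show "degree ?B \<le> m + q - 1 - n0"
  proof (intro degree_add_le degree_sum_le)
    show "degree (monom (c n) (m + q - 1 - n)) \<le> m + q - 1 - n0" for n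
      using zero[of n] degree_monom_le[of "c n" "m + q - 1 - n"] by (cases "n < n0") auto
    show "degree (monom (c (n + q) - c n) (m - 1 - n)) \<le> m + q - 1 - n0" for n
      \<comment> \<open>The second sum has degree below \<open>m\<close>; \<open>q \<ge> n0\<close>
        brings it under the same bound.\<close>
      using q degree_monom_le[of "c (n + q) - c n" "m - 1 - n"] by linarith
  qed auto
  fix w :: complex
  assume w: "cmod w > 1"
  then have w0: "w \<noteq> 0" by auto
  define t where "t n = of_int (c n) / w ^ Suc n" for n
  have t: "t sums S w" unfolding t_def by (rule sum[OF w])
  have "(\<lambda>n. w ^ q * t (n + q)) sums (w ^ q * (S w - (\<Sum>n<q. t n)))"
    by (intro sums_mult sums_split_initial_segment t)
  then have "(\<lambda>n. w ^ q * t (n + q) - t n) sums (w ^ q * (S w - (\<Sum>n<q. t n)) - S w)"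
    using t by (rule sums_diff)
  moreover have "w ^ q * t (n + q) - t n = of_int (c (n + q) - c n) / w ^ Suc n" for n
    using w0 by (simp add: t_def power_add field_simps)
  ultimately have "(\<lambda>n. of_int (c (n + q) - c n) / w ^ Suc n) sums (w ^ q * (S w - (\<Sum>n<q. t n)) - S w)"
    by simp
  moreover have "(\<lambda>n. of_int (c (n + q) - c n) / w ^ Suc n) sums
      (\<Sum>n<m. of_int (c (n + q) - c n) / w ^ Suc n)"
    using per by (intro sums_finite) (auto simp: not_less)
  ultimately have "w ^ q * (S w - (\<Sum>n<q. t n)) - S w
      = (\<Sum>n<m. of_int (c (n + q) - c n) / w ^ Suc n)"
    by (rule sums_unique2)
  then have "S w * (w ^ q - 1) = w ^ q * (\<Sum>n<q. t n)
      + (\<Sum>n<m. of_int (c (n + q) - c n) / w ^ Suc n)"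
    by (simp add: algebra_simps)
  then have "w ^ m * (S w * (w ^ q - 1)) = w ^ m * (w ^ q * (\<Sum>n<q. t n)
      + (\<Sum>n<m. of_int (c (n + q) - c n) / w ^ Suc n))"
    by (rule arg_cong)
  then have "S w * (w ^ m * (w ^ q - 1)) = w ^ (m + q) * (\<Sum>n<q. t n)
      + w ^ m * (\<Sum>n<m. of_int (c (n + q) - c n) / w ^ Suc n)"
    by (simp only: distrib_left power_add mult.assoc mult.left_commute)
  also have "w ^ (m + q) * (\<Sum>n<q. t n) = (\<Sum>n<q. int_eval w (monom (c n) (m + q - 1 - n)))"
    unfolding sum_distrib_left
  proof (rule sum.cong)
    fix n assume "n \<in> {..<q}"
    then have "m + q = (m + q - 1 - n) + Suc n" by simp
    then have "w ^ (m + q) = w ^ (m + q - 1 - n) * w ^ Suc n" by (metis power_add)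
    then show "w ^ (m + q) * t n = int_eval w (monom (c n) (m + q - 1 - n))"
      using w0 by (simp add: t_def)
  qed simp
  also have "w ^ m * (\<Sum>n<m. of_int (c (n + q) - c n) / w ^ Suc n)
     = (\<Sum>n<m. int_eval w (monom (c (n + q) - c n) (m - 1 - n)))"
    unfolding sum_distrib_left
  proof (rule sum.cong)
    fix n assume "n \<in> {..<m}"
    then have "m = (m - 1 - n) + Suc n" by simp
    then have "w ^ m = w ^ (m - 1 - n) * w ^ Suc n" by (metis power_add)
    then show "w ^ m * (of_int (c (n + q) - c n) / w ^ Suc n)
       = int_eval w (monom (c (n + q) - c n) (m - 1 - n))"
      using w0 by simp
  qed simp
  finally show "S w * (w ^ m * (w ^ q - 1)) = int_eval w ?B"
    by (simp only: int_eval.hom_add int_eval.hom_sum)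
qed

section \<open>Field membership, irreducible factors, periods and convergence\<close>

lemma int_eval_of_real:
  "int_eval (of_real d) f = of_real (poly (map_poly of_int f) d)"
  by (induction f) (simp_all add: int_eval_def hom_distribs)

lemma in_Q_adjoin_of_int_polys:
  assumes "int_eval (of_real d) g \<noteq> 0" "of_real y * int_eval (of_real d) g = int_eval (of_real d) f"
  shows "in_Q_adjoin d y"
proof -
  have *: "poly (map_poly of_rat (map_poly of_int h)) d = poly (map_poly of_int h) d" for h :: "int poly"
    by (simp add: map_poly_map_poly o_def)
  have "poly (map_poly of_int g) d \<noteq> 0" "y * poly (map_poly of_int g) d = poly (map_poly of_int f) d"
    using assms unfolding int_eval_of_real of_real_mult[symmetric] of_real_eq_iff by auto
  then have "poly (map_poly of_rat (map_poly of_int g)) d \<noteq> 0 \<and>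
      y = poly (map_poly of_rat (map_poly of_int f)) d / poly (map_poly of_rat (map_poly of_int g)) d"
    by (simp add: * field_simps)
  then show ?thesis unfolding in_Q_adjoin_def by blast
qed

text \<open>The complex numbers have no zero divisors, so along a prime factorisation some factor
  vanishes at \<open>z\<close>; a unit never does.\<close>

lemma irreducible_root_factor:
  fixes T :: "int poly"
  assumes "T \<noteq> 0" "int_eval z T = 0"
  shows "\<exists>P. irreducible P \<and> int_eval z P = 0"
  using assms
proof (induction T rule: prime_divisors_induct)
  case (unit T)
  then obtain S where "T * S = 1" by (metis dvdE)
  then have "int_eval z T * int_eval z S = 1" by (metis int_eval.hom_mult int_eval.hom_one)
  then show ?case using unit by simp
next
  case (factor P T)
  then show ?case
    by (cases "int_eval z P = 0") (auto simp: int_eval.hom_mult prime_elem_imp_irreducible prime_def)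
qed simp

lemma eventually_periodic_multiple:
  fixes a :: "nat \<Rightarrow> 'a" and t :: nat
  assumes "\<And>n. n \<ge> N \<Longrightarrow> a (n + q) = a n" "n \<ge> N"
  shows "a (n + q * t) = a n"
proof (induction t)
  case (Suc t)
  have "a (n + q * Suc t) = a (n + q * t + q)" by (simp add: algebra_simps)
  also have "\<dots> = a (n + q * t)" using assms(2) by (intro assms(1)) simp
  finally show ?case using Suc by simp
qed simp

lemma summable_bounded_geometric:
  fixes c :: "nat \<Rightarrow> complex" and w :: complex
  assumes "\<And>n. cmod (c n) \<le> C" "cmod w > 1"
  shows "summable (\<lambda>n. c n / w ^ Suc n)"
proof (rule summable_comparison_test')
  show "summable (\<lambda>n. C / cmod w * (1 / cmod w) ^ n)"
    using assms(2) by (intro summable_mult summable_geometric) (simp add: divide_simps)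
  show "norm (c n / w ^ Suc n) \<le> C / cmod w * (1 / cmod w) ^ n" if "n \<ge> 0" for n
    using divide_right_mono[OF assms(1)[of n], of "cmod w ^ Suc n"]
    by (simp add: norm_divide norm_power norm_mult power_divide)
qed

section \<open>Greedy expansions and their block series\<close>

locale alternate_base =
  fixes bs :: "real list"
  assumes base: "alt_base bs"
begin

abbreviation "p \<equiv> length bs"
abbreviation "\<delta> \<equiv> prod_list bs"

text \<open>With positions counted from 0, \<open>suffix_prod (Suc j)\<close> is the weight of digit
  \<open>j\<close> within a block.\<close>

definition suffix_prod :: "nat \<Rightarrow> real" where
  "suffix_prod i = prod_list (drop i bs)"

definition prefix_prod :: "nat \<Rightarrow> real" where
  "prefix_prod k = (\<Prod>j<k. abase bs j)"

section \<open>Products of bases\<close>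

lemma length_pos: "p > 0"
  using base by (auto simp: alt_base_def)

lemma zero_notin_base [simp]: "0 \<notin> set bs"
  using base by (auto simp: alt_base_def)

lemma abase_gt_1: "abase bs k > 1"
proof -
  have "bs ! (k mod p) \<in> set bs" using length_pos by simp
  then show ?thesis using base by (auto simp: alt_base_def abase_def)
qed

lemma suffix_prod_Suc: "i < p \<Longrightarrow> suffix_prod i = bs ! i * suffix_prod (Suc i)"
  unfolding suffix_prod_def by (metis Cons_nth_drop_Suc prod_list.Cons)

lemma suffix_prod_length: "suffix_prod p = 1"
  by (simp add: suffix_prod_def)

lemma suffix_prod_0: "suffix_prod 0 = \<delta>"
  by (simp add: suffix_prod_def)

lemma suffix_prod_ge_1: "suffix_prod i \<ge> 1"
proof -
  have "(\<forall>b\<in>set l. b > 1) \<Longrightarrow> prod_list l \<ge> 1" for l :: "real list"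
  proof (induction l)
    case (Cons a l)
    then have "1 * 1 \<le> a * prod_list l" by (intro mult_mono) auto
    then show ?case by simp
  qed simp
  moreover have "\<forall>b\<in>set (drop i bs). b > 1"
    using base set_drop_subset[of i bs] by (auto simp: alt_base_def)
  ultimately show ?thesis by (simp add: suffix_prod_def)
qed

lemma prefix_prod_Suc: "prefix_prod (Suc k) = prefix_prod k * abase bs k"
  by (simp add: prefix_prod_def)

lemma prefix_prod_ge_1: "prefix_prod k \<ge> 1"
  unfolding prefix_prod_def using abase_gt_1 by (intro prod_ge_1) (simp add: less_imp_le)

lemma prefix_prod_mono: "i \<le> k \<Longrightarrow> prefix_prod i \<le> prefix_prod k"
proof (induction k)
  case (Suc k)
  have "prefix_prod k * 1 \<le> prefix_prod (Suc k)"
    unfolding prefix_prod_Suc using abase_gt_1[of k] prefix_prod_ge_1[of k]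
    by (intro mult_left_mono) auto
  with Suc show ?case by (cases "i = Suc k") auto
qed simp

lemma prefix_prod_suffix_prod: "i \<le> p \<Longrightarrow> prefix_prod i * suffix_prod i = \<delta>"
proof (induction i)
  case 0
  then show ?case by (simp add: prefix_prod_def suffix_prod_0)
next
  case (Suc i)
  then have "abase bs i = bs ! i" by (simp add: abase_def)
  with Suc show ?case by (simp add: prefix_prod_Suc suffix_prod_Suc mult.assoc)
qed

lemma prefix_prod_length: "prefix_prod p = \<delta>"
  using prefix_prod_suffix_prod[of p] by (simp add: suffix_prod_length)

lemma delta_gt_1: "\<delta> > 1"
proof -
  have "\<delta> = bs ! 0 * suffix_prod 1"
    using suffix_prod_Suc[of 0] length_pos by (simp add: suffix_prod_0)
  moreover have "bs ! 0 > 1" using abase_gt_1[of 0] by (simp add: abase_def)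
  ultimately show ?thesis
    using suffix_prod_ge_1[of 1] by (simp add: less_le_trans mult_le_cancel_left1)
qed

lemma prefix_prod_shift: "prefix_prod (p + k) = \<delta> * prefix_prod k"
  by (induction k) (simp_all add: prefix_prod_Suc prefix_prod_length abase_def,
      simp add: prefix_prod_def)

lemma prefix_prod_block: "prefix_prod (n * p) = \<delta> ^ n"
  by (induction n) (simp_all add: prefix_prod_shift, simp add: prefix_prod_def)

lemma abase_le_delta: "abase bs k \<le> \<delta>"
proof -
  define i where "i = k mod p"
  have i: "i < p" using length_pos by (simp add: i_def)
  have a: "abase bs k = abase bs i" by (simp add: abase_def i_def)
  have "1 * abase bs i \<le> prefix_prod (Suc i)"
    unfolding prefix_prod_Suc using prefix_prod_ge_1[of i] abase_gt_1[of i]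
    by (intro mult_right_mono) auto
  also have "\<dots> \<le> prefix_prod p" using i by (intro prefix_prod_mono) simp
  finally show ?thesis by (simp add: a prefix_prod_length)
qed

section \<open>Greedy remainders and digits, block by block\<close>

lemma greedy_rem_bounds:
  assumes "0 \<le> x" "x < 1"
  shows "0 \<le> greedy_rem bs x k \<and> greedy_rem bs x k < 1"
  using assms by (induction k) (auto simp: floor_correct, linarith+)

lemma greedy_rem_Suc_digit:
  "greedy_rem bs x (Suc k) = abase bs k * greedy_rem bs x k - of_int (greedy_digit bs x k)"
  by (simp add: greedy_digit_def)

lemma greedy_digit_bounds:
  assumes "0 \<le> x" "x < 1"
  shows "0 \<le> greedy_digit bs x k" "of_int (greedy_digit bs x k) \<le> \<delta>"
proof -
  note r = greedy_rem_bounds[OF assms, of k]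
  have b: "abase bs k > 0" using abase_gt_1[of k] by simp
  then show "0 \<le> greedy_digit bs x k" using r by (simp add: greedy_digit_def)
  have "of_int (greedy_digit bs x k) \<le> abase bs k * greedy_rem bs x k"
    by (simp add: greedy_digit_def)
  also have "\<dots> \<le> abase bs k * 1" using b r by (intro mult_left_mono) auto
  also have "\<dots> \<le> \<delta>" using abase_le_delta by simp
  finally show "of_int (greedy_digit bs x k) \<le> \<delta>" .
qed

text \<open>Scaling by \<open>suffix_prod i\<close> turns the remainder recursion inside a block
  into a telescoping sum without denominators.\<close>

lemma greedy_rem_within_block:
  "i \<le> p \<Longrightarrow> suffix_prod i * greedy_rem bs x (n * p + i) =
     \<delta> * greedy_rem bs x (n * p)
     - (\<Sum>j<i. suffix_prod (Suc j) * of_int (greedy_digit bs x (n * p + j)))"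
proof (induction i)
  case 0
  then show ?case by (simp add: suffix_prod_0)
next
  case (Suc i)
  then have i: "i < p" by simp
  then have a: "abase bs (n * p + i) = bs ! i" by (simp add: abase_def)
  have "suffix_prod (Suc i) * greedy_rem bs x (n * p + Suc i) =
      suffix_prod i * greedy_rem bs x (n * p + i)
      - suffix_prod (Suc i) * of_int (greedy_digit bs x (n * p + i))"
    by (simp only: add_Suc_right greedy_rem_Suc_digit a suffix_prod_Suc[OF i])
       (simp add: algebra_simps)
  then show ?case using Suc i by simp
qed

lemma partial_expansion:
  "x = (\<Sum>n<M. (\<Sum>j<p. suffix_prod (Suc j) * of_int (greedy_digit bs x (n * p + j))) / \<delta> ^ Suc n)
       + greedy_rem bs x (M * p) / \<delta> ^ M"
proof (induction M)
  case (Suc M)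
  have "greedy_rem bs x (Suc M * p) = \<delta> * greedy_rem bs x (M * p)
     - (\<Sum>j<p. suffix_prod (Suc j) * of_int (greedy_digit bs x (M * p + j)))"
    using greedy_rem_within_block[of p x M] by (simp add: suffix_prod_length add.commute)
  then have "greedy_rem bs x (M * p) / \<delta> ^ M =
     (\<Sum>j<p. suffix_prod (Suc j) * of_int (greedy_digit bs x (M * p + j))) / \<delta> ^ Suc M
     + greedy_rem bs x (Suc M * p) / \<delta> ^ Suc M"
    using delta_gt_1 by (auto simp: diff_divide_distrib)
  with Suc show ?case by simp
qed simp

section \<open>Digit series as functions of a complex variable\<close>

definition digit_series :: "real \<Rightarrow> nat \<Rightarrow> complex \<Rightarrow> complex" where
  "digit_series x j w = (\<Sum>n. of_int (greedy_digit bs x (n * p + j)) / w ^ Suc n)"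

lemma norm_digit_le:
  assumes "0 \<le> x" "x < 1"
  shows "cmod (of_int (greedy_digit bs x k)) \<le> \<delta>"
  using greedy_digit_bounds[OF assms, of k] by simp

lemma digit_series_sums:
  assumes "0 \<le> x" "x < 1" "cmod w > 1"
  shows "(\<lambda>n. of_int (greedy_digit bs x (n * p + j)) / w ^ Suc n) sums digit_series x j w"
  unfolding digit_series_def
  using summable_bounded_geometric[OF norm_digit_le[OF assms(1,2)] assms(3)]
  by (rule summable_sums)

text \<open>Remainders stay below 1, so the error after \<open>M\<close> blocks is at most
  \<open>1 / \<delta> ^ M\<close>; the resulting series of blocks is then split by position
  \<open>j\<close>.\<close>

lemma expansion:
  assumes "0 \<le> x" "x < 1"
  shows "of_real x = (\<Sum>j<p. of_real (suffix_prod (Suc j)) * digit_series x j (of_real \<delta>))"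
proof -
  define d where "d n = (\<Sum>j<p. suffix_prod (Suc j) * of_int (greedy_digit bs x (n * p + j))) / \<delta> ^ Suc n"
    for n
  have \<delta>: "cmod (of_real \<delta>) > 1" using delta_gt_1 by simp
  have "(\<lambda>M. greedy_rem bs x (M * p) / \<delta> ^ M) \<longlonglongrightarrow> 0"
  proof (rule tendsto_0_le[where K = 1])
    show "\<forall>\<^sub>F M in sequentially. norm (greedy_rem bs x (M * p) / \<delta> ^ M) \<le> norm ((1 / \<delta>) ^ M) * 1"
      using greedy_rem_bounds[OF assms] delta_gt_1
      by (intro always_eventually) (simp add: power_divide divide_right_mono abs_of_nonneg less_imp_le)
    show "(\<lambda>M. (1 / \<delta>) ^ M) \<longlonglongrightarrow> 0"
      using delta_gt_1 by (intro LIMSEQ_power_zero) simp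
  qed
  then have "(\<lambda>M. x - greedy_rem bs x (M * p) / \<delta> ^ M) \<longlonglongrightarrow> x - 0"
    by (intro tendsto_diff tendsto_const)
  moreover have "x - greedy_rem bs x (M * p) / \<delta> ^ M = (\<Sum>n<M. d n)" for M
    using partial_expansion[of x M] by (simp add: d_def)
  ultimately have "d sums x" by (simp add: sums_def)
  then have "(\<lambda>n. of_real (d n)) sums (of_real x :: complex)"
    by (rule sums_of_real)
  moreover have "(\<lambda>n. of_real (d n)) sums
     (\<Sum>j<p. of_real (suffix_prod (Suc j)) * digit_series x j (of_real \<delta>))"
  proof -
    have "of_real (d n) = (\<Sum>j<p. of_real (suffix_prod (Suc j)) *
            (of_int (greedy_digit bs x (n * p + j)) / of_real \<delta> ^ Suc n :: complex))" for n
      by (simp add: d_def sum_divide_distrib)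
    then show ?thesis
      using digit_series_sums[OF assms \<delta>] by (simp only:) (intro sums_sum sums_mult)
  qed
  ultimately show ?thesis by (rule sums_unique2)
qed

text \<open>After block 0 the next possible nonzero digit is in block \<open>L\<close>; digits are
  at most \<delta>, so a geometric series bounds the tail.\<close>

lemma digit_series_tail:
  assumes x: "0 \<le> x" "x < 1" and w: "cmod w > 1"
    and zero: "\<And>n. 0 < n \<Longrightarrow> n < L \<Longrightarrow> greedy_digit bs x (n * p + j) = 0" and "L > 0"
  shows "cmod (digit_series x j w - of_int (greedy_digit bs x j) / w)
           \<le> \<delta> / (cmod w - 1) / cmod w ^ L"
proof -
  define c where "c n = (of_int (greedy_digit bs x (n * p + j)) :: complex)" for n
  have s: "(\<lambda>n. c n / w ^ Suc n) sums digit_series x j w"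
    unfolding c_def by (rule digit_series_sums[OF x w])
  have "(\<Sum>n<L. c n / w ^ Suc n) = (\<Sum>n\<in>{0}. c n / w ^ Suc n)"
    using \<open>L > 0\<close> zero by (intro sum.mono_neutral_right) (auto simp: c_def)
  then have t: "(\<lambda>n. c (n + L) / w ^ Suc (n + L)) sums (digit_series x j w - c 0 / w)"
    using sums_split_initial_segment[OF s, of L] by simp
  have g: "(\<lambda>n. \<delta> / cmod w ^ Suc L * (1 / cmod w) ^ n) sums
      (\<delta> / cmod w ^ Suc L * (1 / (1 - 1 / cmod w)))"
    using w by (intro sums_mult geometric_sums) (simp add: divide_simps)
  have "cmod (digit_series x j w - c 0 / w) \<le> \<delta> / cmod w ^ Suc L * (1 / (1 - 1 / cmod w))"
    unfolding sums_unique[OF t] sums_unique[OF g]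
  proof (rule norm_suminf_le)
    fix n
    have "cmod (c (n + L)) / cmod w ^ Suc (n + L) \<le> \<delta> / cmod w ^ Suc (n + L)"
      using norm_digit_le[OF x] by (intro divide_right_mono) (auto simp: c_def)
    then show "norm (c (n + L) / w ^ Suc (n + L)) \<le> \<delta> / cmod w ^ Suc L * (1 / cmod w) ^ n"
      by (simp add: norm_divide norm_power norm_mult power_divide power_add mult_ac)
  qed (use g in \<open>simp add: sums_iff\<close>)
  also have "\<dots> = \<delta> / (cmod w - 1) / cmod w ^ L"
    using w by (auto simp: divide_simps)
  finally show ?thesis by (simp add: c_def)
qed

section \<open>Rationals with prescribed leading digits\<close>

lemma greedy_leading_zeros:
  assumes "0 \<le> x" "prefix_prod k * x < 1"
  shows "greedy_rem bs x k = prefix_prod k * x" "\<And>j. j < k \<Longrightarrow> greedy_digit bs x j = 0"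
proof -
  have *: "prefix_prod j * x < 1" if "j \<le> k" for j
    using mult_right_mono[OF prefix_prod_mono[OF that] assms(1)] assms(2) by linarith
  have r: "j \<le> k \<Longrightarrow> greedy_rem bs x j = prefix_prod j * x" for j
  proof (induction j)
    case 0
    then show ?case by (simp add: prefix_prod_def)
  next
    case (Suc j)
    have "\<lfloor>abase bs j * (prefix_prod j * x)\<rfloor> = 0"
      using *[OF Suc.prems] assms(1) prefix_prod_ge_1[of "Suc j"]
      by (simp add: floor_eq_iff prefix_prod_Suc mult_ac)
    then show ?case using Suc by (simp add: prefix_prod_Suc)
  qed
  then show "greedy_rem bs x k = prefix_prod k * x" by simp
  show "greedy_digit bs x j = 0" if "j < k" for j
    using *[of "Suc j"] that assms(1) prefix_prod_ge_1[of "Suc j"]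
    by (simp add: greedy_digit_def r floor_eq_iff prefix_prod_Suc mult_ac)
qed

text \<open>The point \<open>1 / prefix_prod (Suc i)\<close> would be exhausted by a single digit 1
  at position \<open>i\<close>; a rational slightly above it starts the same way and leaves a
  remainder that stays below 1 for \<open>L\<close> blocks.\<close>

lemma rational_with_unit_prefix:
  assumes i: "i < p" and "L > 0"
  obtains x where "x \<in> \<rat>" "0 \<le> x" "x < 1" "\<bar>x - 1 / prefix_prod (Suc i)\<bar> < 1 / \<delta> ^ L"
    "\<And>k. k < L * p \<Longrightarrow> greedy_digit bs x k = (if k = i then 1 else 0)"
proof -
  define y where "y = 1 / prefix_prod (Suc i)"
  have P: "prefix_prod k > 0" for k using prefix_prod_ge_1[of k] by linarith
  have "y < 1 / prefix_prod i"
    using P[of i] abase_gt_1[of i] by (simp add: y_def prefix_prod_Suc field_simps)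
  moreover have "y < 2 * y" using P[of "Suc i"] by (simp add: y_def divide_simps)
  moreover have "y < y + 1 / \<delta> ^ L" using delta_gt_1 by simp
  \<comment> \<open>The three bounds give, in order, zeros before position \<open>i\<close>, a digit
    at \<open>i\<close> below 2, and zeros after \<open>i\<close> up to the end of block
    \<open>L\<close>.\<close>
  ultimately have "y < Min {1 / prefix_prod i, 2 * y, y + 1 / \<delta> ^ L}" by simp
  then obtain x where x: "x \<in> \<rat>" "y < x" and "x < Min {1 / prefix_prod i, 2 * y, y + 1 / \<delta> ^ L}"
    using Rats_dense_in_real by blast
  then have x1: "x < 1 / prefix_prod i" and x2: "x < 2 * y" and x3: "x < y + 1 / \<delta> ^ L" by auto
  have y0: "y > 0" using P[of "Suc i"] by (simp add: y_def)
  have "1 / prefix_prod i \<le> 1" using prefix_prod_ge_1[of i] by simp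
  then have x01: "0 \<le> x" "x < 1" using x y0 x1 by linarith+
  have "prefix_prod i * x < 1" using x1 P[of i] by (simp add: field_simps)
  note lz = greedy_leading_zeros[OF x01(1) this]
  have fl: "greedy_digit bs x i = 1"
    using x x2 P[of "Suc i"]
    by (simp add: greedy_digit_def lz(1) floor_eq_iff y_def prefix_prod_Suc field_simps)
  have small: "0 \<le> prefix_prod k * (x - y) \<and> prefix_prod k * (x - y) < 1" if "k \<le> L * p" for k
  proof -
    have "prefix_prod k * (x - y) \<le> prefix_prod (L * p) * (x - y)"
      using x that by (intro mult_right_mono prefix_prod_mono) auto
    also have "\<dots> = \<delta> ^ L * (x - y)" by (simp add: prefix_prod_block)
    also have "\<dots> < \<delta> ^ L * (1 / \<delta> ^ L)"
      using x3 delta_gt_1 by (intro mult_strict_left_mono) auto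
    also have "\<dots> = 1" using delta_gt_1 by auto
    finally show ?thesis using P[of k] x by simp
  qed
  \<comment> \<open>Once the digit 1 is removed, what remains is the scaled excess
    \<open>x - y\<close>.\<close>
  have r: "Suc i \<le> k \<Longrightarrow> k \<le> L * p \<Longrightarrow> greedy_rem bs x k = prefix_prod k * (x - y)" for k
  proof (induction k rule: dec_induct)
    case base
    show ?case
      unfolding greedy_rem_Suc_digit fl lz(1)
      using P[of i] abase_gt_1[of i] by (simp add: y_def prefix_prod_Suc field_simps)
  next
    case (step k)
    have "\<lfloor>abase bs k * (prefix_prod k * (x - y))\<rfloor> = 0"
      using small[OF step.prems] by (simp add: floor_eq_iff prefix_prod_Suc mult_ac)
    then show ?case using step by (simp add: prefix_prod_Suc)
  qed
  have "greedy_digit bs x k = (if k = i then 1 else 0)" if "k < L * p" for k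
  proof (cases "k > i")
    case True
    then show ?thesis
      using small[of "Suc k"] that
      by (simp add: greedy_digit_def r floor_eq_iff prefix_prod_Suc mult_ac)
  qed (use fl lz(2) in auto)
  moreover have "\<bar>x - y\<bar> < 1 / \<delta> ^ L" using x x3 by simp
  ultimately show thesis using that x x01 by (simp add: y_def)
qed

end

section \<open>Bases in which all rationals are eventually periodic\<close>

locale rational_periodic_base = alternate_base +
  assumes rational_periodic: "\<forall>x \<in> \<rat>. 0 \<le> x \<and> x < 1 \<longrightarrow> x \<in> Per bs"
begin

abbreviation "\<delta>\<^sub>c \<equiv> complex_of_real \<delta>"

lemma norm_delta: "cmod \<delta>\<^sub>c > 1"
  using delta_gt_1 by simp

text \<open>Eventual periodicity of the digits is inherited by each position \<open>j\<close> of the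
  blocks, with \<open>m\<close> and \<open>q\<close> common to all \<open>j\<close>;
  \<open>n0\<close> zero blocks lower the numerator degrees.\<close>

lemma digit_series_rational_function:
  assumes x: "x \<in> \<rat>" "0 \<le> x" "x < 1"
    and zero: "\<And>k. k < n0 * p \<Longrightarrow> greedy_digit bs x k = 0"
  obtains m q B where "q > n0" "\<And>j. j < p \<Longrightarrow> degree (B j) \<le> m + q - 1 - n0"
    "\<And>j w. j < p \<Longrightarrow> cmod w > 1 \<Longrightarrow> digit_series x j w * (w ^ m * (w ^ q - 1)) = int_eval w (B j)"
proof -
  obtain N Q where Q: "Q > 0" and per: "\<And>n. n \<ge> N \<Longrightarrow> greedy_digit bs x (n + Q) = greedy_digit bs x n"
    using rational_periodic x unfolding Per_def eventually_periodic_def by blast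
  \<comment> \<open>A shift by \<open>q\<close> blocks is \<open>q * p\<close> digits, a multiple of
    the digit period \<open>Q\<close>; the factor \<open>Suc n0\<close> makes \<open>q\<close>
    exceed \<open>n0\<close>.\<close>
  define q where "q = Q * Suc n0"
  have q: "q > n0" using Q mult_le_mono1[of 1 Q "Suc n0"] by (simp add: q_def)
  have "\<exists>B. degree B \<le> N + q - 1 - n0 \<and>
      (\<forall>w. cmod w > 1 \<longrightarrow> digit_series x j w * (w ^ N * (w ^ q - 1)) = int_eval w B)" if j: "j < p" for j
  proof -
    obtain B where "degree B \<le> N + q - 1 - n0"
      "\<And>w. cmod w > 1 \<Longrightarrow> digit_series x j w * (w ^ N * (w ^ q - 1)) = int_eval w B"
    proof (rule eventually_periodic_series[where c = "\<lambda>n. greedy_digit bs x (n * p + j)"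
          and S = "digit_series x j" and m = N and q = q and ?n0.0 = n0])
      fix n assume n: "n \<ge> N"
      have "N * 1 \<le> n * p" using n length_pos by (intro mult_le_mono) (auto simp: Suc_le_eq)
      then have "n * p + j \<ge> N" by simp
      then have "greedy_digit bs x (n * p + j + Q * (Suc n0 * p)) = greedy_digit bs x (n * p + j)"
        using per by (intro eventually_periodic_multiple) auto
      moreover have "(n + q) * p + j = n * p + j + Q * (Suc n0 * p)"
        by (simp add: q_def algebra_simps)
      ultimately show "greedy_digit bs x ((n + q) * p + j) = greedy_digit bs x (n * p + j)"
        by (simp only:)
    next
      fix n assume "n < n0"
      then have "Suc n * p \<le> n0 * p" by (intro mult_le_mono) auto
      then show "greedy_digit bs x (n * p + j) = 0" using j by (intro zero) simp
    qed (use digit_series_sums[OF x(2,3)] q in auto)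
    then show ?thesis by blast
  qed
  then obtain B where "\<And>j. j < p \<Longrightarrow> degree (B j) \<le> N + q - 1 - n0 \<and>
      (\<forall>w. cmod w > 1 \<longrightarrow> digit_series x j w * (w ^ N * (w ^ q - 1)) = int_eval w (B j))"
    by metis
  then show thesis using that[of q B N] q by blast
qed

text \<open>The same \<open>x\<close> works for every \<open>w\<close> outside the closed unit disc:
  at \<delta> this gives diagonal dominance, at another point \<open>z\<close> the comparison of
  \<open>1 / z\<close> with \<open>1 / \<delta>\<close>.\<close>

lemma unit_prefix_digit_series:
  assumes "i < p" "L > 0"
  obtains x where "x \<in> \<rat>" "0 \<le> x" "x < 1" "\<bar>x - 1 / prefix_prod (Suc i)\<bar> < 1 / \<delta> ^ L"
    "\<And>j w. j < p \<Longrightarrow> cmod w > 1 \<Longrightarrow>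
       cmod (digit_series x j w - (if j = i then 1 / w else 0)) \<le> \<delta> / (cmod w - 1) / cmod w ^ L"
proof -
  obtain x where x: "x \<in> \<rat>" "0 \<le> x" "x < 1" "\<bar>x - 1 / prefix_prod (Suc i)\<bar> < 1 / \<delta> ^ L"
    and dig: "\<And>k. k < L * p \<Longrightarrow> greedy_digit bs x k = (if k = i then 1 else 0)"
    using rational_with_unit_prefix[OF assms] by metis
  have "cmod (digit_series x j w - (if j = i then 1 / w else 0)) \<le> \<delta> / (cmod w - 1) / cmod w ^ L"
    if j: "j < p" and w: "cmod w > 1" for j w
  proof -
    have *: "n * p + j < L * p" if "n < L" for n
    proof -
      have "Suc n * p \<le> L * p" using that by (intro mult_le_mono) auto
      then show ?thesis using j by simp
    qed
    have "greedy_digit bs x (n * p + j) = 0" if "0 < n" "n < L" for n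
    proof -
      have "n * p \<ge> 1 * p" using that by (intro mult_le_mono) auto
      then have "n * p + j \<noteq> i" using assms(1) by linarith
      then show ?thesis using dig[OF *[OF that(2)]] by simp
    qed
    from digit_series_tail[OF x(2,3) w this assms(2)] show ?thesis
      using dig[of j] *[of 0] assms(2) by (auto split: if_splits)
  qed
  with x that show thesis by blast
qed

section \<open>Linear relations for the suffix products\<close>

text \<open>This is row \<open>i\<close> of the linear system: the expansion of a rational whose
  series at \<delta> is within \<epsilon> of \<open>1 / \<delta>\<close> at position
  \<open>i\<close> and of 0 elsewhere.\<close>

lemma dominant_relation:
  assumes i: "i < p"
  shows "\<exists>B R. (\<Sum>j<p. int_eval \<delta>\<^sub>c (B j) * of_real (suffix_prod (Suc j))) = int_eval \<delta>\<^sub>c R \<and>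
     (\<Sum>j\<in>{..<p} - {i}. cmod (int_eval \<delta>\<^sub>c (B j))) < cmod (int_eval \<delta>\<^sub>c (B i))"
proof -
  \<comment> \<open>The threshold is what \<open>p * \<epsilon> < 1 / \<delta>\<close> amounts to
    for the tail bound \<epsilon> defined below; the successor makes \<open>L\<close>
    positive.\<close>
  obtain L0 where L0: "of_nat p * \<delta> * \<delta> / (\<delta> - 1) < \<delta> ^ L0"
    using real_arch_pow[OF delta_gt_1] by blast
  define L where "L = Suc L0"
  have "\<delta> ^ L0 \<le> \<delta> ^ L" using delta_gt_1 by (simp add: L_def)
  with L0 have L: "of_nat p * \<delta> * \<delta> / (\<delta> - 1) < \<delta> ^ L" by linarith
  define \<epsilon> where "\<epsilon> = \<delta> / (\<delta> - 1) / \<delta> ^ L"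
  have "of_nat p * \<epsilon> * \<delta> = of_nat p * \<delta> * \<delta> / (\<delta> - 1) / \<delta> ^ L" by (simp add: \<epsilon>_def)
  also have "\<dots> < 1" using L delta_gt_1 by (subst pos_divide_less_eq) auto
  finally have \<epsilon>: "of_nat p * \<epsilon> < 1 / \<delta>" using delta_gt_1 by (simp add: pos_less_divide_eq)
  have "L > 0" by (simp add: L_def)
  then obtain x where x: "x \<in> \<rat>" "0 \<le> x" "x < 1" and "\<bar>x - 1 / prefix_prod (Suc i)\<bar> < 1 / \<delta> ^ L" and
    S: "\<And>j w. j < p \<Longrightarrow> cmod w > 1 \<Longrightarrow>
       cmod (digit_series x j w - (if j = i then 1 / w else 0)) \<le> \<delta> / (cmod w - 1) / cmod w ^ L"
    using unit_prefix_digit_series[OF i, of L] by metis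
  define s where "s j = digit_series x j \<delta>\<^sub>c" for j
  have s: "cmod (s j - (if j = i then 1 / \<delta>\<^sub>c else 0)) \<le> \<epsilon>" if "j < p" for j
    using S[OF that norm_delta] delta_gt_1 by (simp add: s_def \<epsilon>_def)
  have "(\<Sum>j\<in>{..<p} - {i}. cmod (s j)) \<le> (\<Sum>j\<in>{..<p} - {i}. \<epsilon>)"
    using s by (intro sum_mono) (metis DiffE diff_zero insertCI lessThan_iff)
  also have "\<dots> = of_nat p * \<epsilon> - \<epsilon>" using i by (simp add: of_nat_diff algebra_simps)
  also have "\<dots> < 1 / \<delta> - \<epsilon>" using \<epsilon> by simp
  also have "\<dots> \<le> cmod (1 / \<delta>\<^sub>c) - cmod (s i - 1 / \<delta>\<^sub>c)"
    using s[OF i] delta_gt_1 by (simp add: norm_divide)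
  also have "\<dots> \<le> cmod (s i)"
    using norm_triangle_ineq2[of "1 / \<delta>\<^sub>c" "1 / \<delta>\<^sub>c - s i"] by (simp add: norm_minus_commute)
  finally have dom: "(\<Sum>j\<in>{..<p} - {i}. cmod (s j)) < cmod (s i)" .
  obtain m q B where q: "q > 0" and
    "\<And>j w. j < p \<Longrightarrow> cmod w > 1 \<Longrightarrow> digit_series x j w * (w ^ m * (w ^ q - 1)) = int_eval w (B j)"
    using digit_series_rational_function[OF x, of 0] by (metis mult_0 not_less_zero)
  then have B: "\<And>j. j < p \<Longrightarrow> s j * (\<delta>\<^sub>c ^ m * (\<delta>\<^sub>c ^ q - 1)) = int_eval \<delta>\<^sub>c (B j)"
    using norm_delta by (simp add: s_def)
  \<comment> \<open>The common factor \<open>W\<close>, and the denominator \<open>b\<close> of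
    \<open>x\<close>, scale the whole row, so dominance survives clearing denominators.\<close>
  define W where "W = \<delta>\<^sub>c ^ m * (\<delta>\<^sub>c ^ q - 1)"
  have "\<delta> ^ q > 1" using q delta_gt_1 by (simp only: one_less_power)
  then have "\<delta> ^ q \<noteq> 1" by linarith
  then have "\<delta>\<^sub>c ^ q \<noteq> 1" by (metis of_real_power of_real_eq_1_iff)
  then have W: "W \<noteq> 0" by (simp add: W_def)
  obtain a b where ab: "b > 0" "x = of_int a / of_int b" using x(1) by (rule Rats_cases')
  define B' where "B' j = [:b:] * B j" for j
  define R where "R = [:a:] * (monom 1 m * (monom 1 q - 1))"
  have B': "int_eval \<delta>\<^sub>c (B' j) = of_int b * W * s j" if "j < p" for j
    using B[OF that] by (simp add: B'_def W_def int_eval.hom_mult mult_ac del: mult_pCons_left)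
  have "(\<Sum>j<p. int_eval \<delta>\<^sub>c (B' j) * of_real (suffix_prod (Suc j)))
      = of_int b * W * (\<Sum>j<p. of_real (suffix_prod (Suc j)) * s j)"
    by (simp add: B' sum_distrib_left mult_ac)
  also have "(\<Sum>j<p. of_real (suffix_prod (Suc j)) * s j) = of_real x"
    using expansion[OF x(2,3)] by (simp add: s_def)
  also have "of_int b * W * of_real x = of_int a * W" using ab by simp
  also have "\<dots> = int_eval \<delta>\<^sub>c R"
    by (simp add: R_def W_def int_eval.hom_mult int_eval.hom_minus del: mult_pCons_left)
  finally have "(\<Sum>j<p. int_eval \<delta>\<^sub>c (B' j) * of_real (suffix_prod (Suc j))) = int_eval \<delta>\<^sub>c R" .
  moreover have "(\<Sum>j\<in>{..<p} - {i}. cmod (int_eval \<delta>\<^sub>c (B' j)))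
      = cmod (of_int b * W) * (\<Sum>j\<in>{..<p} - {i}. cmod (s j))"
    by (simp add: B' norm_mult sum_distrib_left)
  moreover have "\<dots> < cmod (of_int b * W) * cmod (s i)"
    using dom W ab(1) by (intro mult_strict_left_mono) auto
  moreover have "\<dots> = cmod (int_eval \<delta>\<^sub>c (B' i))" using i by (simp add: B' norm_mult)
  ultimately show ?thesis by metis
qed

text \<open>Cramer's rule for the dominant rows; \<open>D\<close> is the determinant, a common
  denominator of all suffix products.\<close>

lemma suffix_prods_in_field:
  obtains D N where "int_eval \<delta>\<^sub>c D \<noteq> 0"
    "\<And>j. j < p \<Longrightarrow> int_eval \<delta>\<^sub>c (N j) = of_real (suffix_prod (Suc j)) * int_eval \<delta>\<^sub>c D"
proof -
  define rel where "rel i B R \<longleftrightarrow>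
      (\<Sum>j<p. int_eval \<delta>\<^sub>c (B j) * of_real (suffix_prod (Suc j))) = int_eval \<delta>\<^sub>c R \<and>
      (\<Sum>j\<in>{..<p} - {i}. cmod (int_eval \<delta>\<^sub>c (B j))) < cmod (int_eval \<delta>\<^sub>c (B i))"
    for i :: nat and B R
  have "\<exists>B R. rel i B R" if "i < p" for i
    unfolding rel_def by (rule dominant_relation[OF that])
  then obtain B R where rel: "\<And>i. i < p \<Longrightarrow> rel i (B i) (R i)" by metis
  then have
    eqs: "\<And>i. i < p \<Longrightarrow>
      (\<Sum>j<p. int_eval \<delta>\<^sub>c (B i j) * of_real (suffix_prod (Suc j))) = int_eval \<delta>\<^sub>c (R i)" and
    dom: "\<And>i. i < p \<Longrightarrow>
      (\<Sum>j\<in>{..<p} - {i}. cmod (int_eval \<delta>\<^sub>c (B i j))) < cmod (int_eval \<delta>\<^sub>c (B i i))"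
    by (simp_all add: rel_def)
  define M where "M = mat p p (\<lambda>(i, j). B i j)"
  have M: "M \<in> carrier_mat p p" by (simp add: M_def)
  have "det (map_mat (int_eval \<delta>\<^sub>c) M) \<noteq> 0"
    using dom by (intro strictly_diagonally_dominant_det_nonzero[of _ p]) (auto simp: M_def)
  then have "int_eval \<delta>\<^sub>c (det M) \<noteq> 0" by simp
  moreover have "int_eval \<delta>\<^sub>c (det (replace_col M (vec p R) j))
      = of_real (suffix_prod (Suc j)) * int_eval \<delta>\<^sub>c (det M)" if "j < p" for j
    using eqs that by (intro cramer_int_poly[OF M, where y = "\<lambda>j. of_real (suffix_prod (Suc j))"])
      (auto simp: M_def)
  ultimately show thesis by (rule that)
qed

section \<open>Conjugates outside the unit disc\<close>

text \<open>The hypothesis on \<open>T\<close> carries the expansions of rationals from \<delta> to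
  \<open>z\<close>, where the digit series still converge. Letting \<open>x\<close> tend to
  \<open>1 / \<delta>\<close> yields \<open>1 / z = 1 / \<delta>\<close>. No minimal polynomial
  enters, so the transcendental case is covered as well.\<close>

lemma conjugate_outside_disc:
  assumes D: "int_eval \<delta>\<^sub>c D \<noteq> 0"
    and N: "\<And>j. j < p \<Longrightarrow> int_eval \<delta>\<^sub>c (N j) = of_real (suffix_prod (Suc j)) * int_eval \<delta>\<^sub>c D"
    and conj: "\<And>T. int_eval \<delta>\<^sub>c T = 0 \<Longrightarrow> int_eval z T = 0"
    and z: "cmod z > 1" and Dz: "int_eval z D \<noteq> 0"
  shows "z = \<delta>\<^sub>c"
proof -
  have expand: "(\<Sum>j<p. int_eval z (N j) * digit_series x j z) = of_real x * int_eval z D"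
    if x: "x \<in> \<rat>" "0 \<le> x" "x < 1" for x
  proof -
    obtain m q B where q: "q > 0" and
      B: "\<And>j w. j < p \<Longrightarrow> cmod w > 1 \<Longrightarrow> digit_series x j w * (w ^ m * (w ^ q - 1)) = int_eval w (B j)"
      using digit_series_rational_function[OF x, of 0] by (metis mult_0 not_less_zero)
    obtain a b where ab: "b > 0" "x = of_int a / of_int b" using x(1) by (rule Rats_cases')
    \<comment> \<open>\<open>T\<close> is the expansion of \<open>x = a / b\<close> with all
      denominators cleared; outside the disc it is a nonzero factor times the wanted
      difference.\<close>
    define T where "T = [:b:] * (\<Sum>j<p. N j * B j) - [:a:] * D * (monom 1 m * (monom 1 q - 1))"
    have T: "int_eval w T = w ^ m * (w ^ q - 1) *
        (of_int b * (\<Sum>j<p. int_eval w (N j) * digit_series x j w) - of_int a * int_eval w D)"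
      if "cmod w > 1" for w
    proof -
      have "int_eval w T = of_int b * (\<Sum>j<p. int_eval w (N j) * int_eval w (B j))
         - of_int a * int_eval w D * (w ^ m * (w ^ q - 1))"
        by (simp add: T_def int_eval.hom_mult int_eval.hom_minus int_eval.hom_sum del: mult_pCons_left)
      also have "(\<Sum>j<p. int_eval w (N j) * int_eval w (B j))
          = (\<Sum>j<p. int_eval w (N j) * digit_series x j w) * (w ^ m * (w ^ q - 1))"
        unfolding sum_distrib_right using B[OF _ that] by (intro sum.cong) (auto simp: mult.assoc)
      finally show ?thesis by (simp add: algebra_simps)
    qed
    have "(\<Sum>j<p. int_eval \<delta>\<^sub>c (N j) * digit_series x j \<delta>\<^sub>c)
        = int_eval \<delta>\<^sub>c D * (\<Sum>j<p. of_real (suffix_prod (Suc j)) * digit_series x j \<delta>\<^sub>c)"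
      by (simp add: N sum_distrib_left mult_ac)
    also have "\<dots> = int_eval \<delta>\<^sub>c D * of_real x" using expansion[OF x(2,3)] by simp
    finally have "int_eval \<delta>\<^sub>c T = 0" using T[OF norm_delta] ab by simp
    then have "int_eval z T = 0" by (rule conj)
    moreover have "z ^ m * (z ^ q - 1) \<noteq> 0"
    proof -
      have "cmod (z ^ q) > 1" using z q by (simp add: norm_power one_less_power)
      then have "z ^ q \<noteq> 1" by auto
      then show ?thesis using z by auto
    qed
    ultimately have "of_int b * (\<Sum>j<p. int_eval z (N j) * digit_series x j z) = of_int a * int_eval z D"
      using T[OF z] by (simp only: mult_eq_0_iff) auto
    moreover have "complex_of_int a = of_int b * of_real x" using ab by simp
    ultimately show ?thesis using ab(1) by (simp only: mult.assoc mult_cancel_left) auto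
  qed
  \<comment> \<open>At the last position the weight is \<open>suffix_prod p = 1\<close> and the
    limit point is \<open>1 / prefix_prod p = 1 / \<delta>\<close>.\<close>
  define i where "i = p - 1"
  have i: "i < p" "Suc i = p" using length_pos by (auto simp: i_def)
  have "int_eval \<delta>\<^sub>c (N i - D) = 0" using N[OF i(1)] i(2) by (simp add: int_eval.hom_minus suffix_prod_length)
  then have "int_eval z (N i - D) = 0" by (rule conj)
  then have Ni: "int_eval z (N i) = int_eval z D" by (simp add: int_eval.hom_minus)
  define K where "K = (\<Sum>j<p. cmod (int_eval z (N j))) * (\<delta> / (cmod z - 1))"
  define e where "e = cmod (int_eval z D * (1 / z - 1 / \<delta>\<^sub>c))"
  \<comment> \<open>\<open>K\<close> collects the digit series errors; the second term is the
    distance from \<open>x\<close> to \<open>1 / \<delta>\<close>. Both vanish as \<open>L\<close>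
    grows, while \<open>e\<close> is fixed.\<close>
  have bound: "e \<le> K * (1 / cmod z) ^ L + cmod (int_eval z D) * (1 / \<delta>) ^ L" if "L > 0" for L
  proof -
    obtain x where x: "x \<in> \<rat>" "0 \<le> x" "x < 1"
      and "\<bar>x - 1 / prefix_prod (Suc i)\<bar> < 1 / \<delta> ^ L" and
      S: "\<And>j w. j < p \<Longrightarrow> cmod w > 1 \<Longrightarrow>
         cmod (digit_series x j w - (if j = i then 1 / w else 0)) \<le> \<delta> / (cmod w - 1) / cmod w ^ L"
      using unit_prefix_digit_series[OF i(1) \<open>L > 0\<close>] by metis
    then have xd: "\<bar>x - 1 / \<delta>\<bar> < 1 / \<delta> ^ L" by (simp add: i(2) prefix_prod_length)
    define t where "t j = digit_series x j z - (if j = i then 1 / z else 0)" for j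
    have "(\<Sum>j<p. int_eval z (N j) * t j)
        = (\<Sum>j<p. int_eval z (N j) * digit_series x j z) - (\<Sum>j<p. if j = i then int_eval z (N j) / z else 0)"
      unfolding t_def sum_subtractf[symmetric] by (intro sum.cong) (auto simp: algebra_simps)
    also have "\<dots> = of_real x * int_eval z D - int_eval z D / z"
      using i(1) by (simp add: expand[OF x] Ni)
    finally have "int_eval z D * (1 / z - 1 / \<delta>\<^sub>c)
        = int_eval z D * of_real (x - 1 / \<delta>) - (\<Sum>j<p. int_eval z (N j) * t j)"
      by (simp add: algebra_simps)
    then have "e \<le> cmod (int_eval z D * of_real (x - 1 / \<delta>)) + cmod (\<Sum>j<p. int_eval z (N j) * t j)"
      unfolding e_def by (metis norm_triangle_ineq4)
    also have "cmod (int_eval z D * of_real (x - 1 / \<delta>)) \<le> cmod (int_eval z D) * (1 / \<delta> ^ L)"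
      unfolding norm_mult norm_of_real using xd by (intro mult_left_mono) auto
    also have "cmod (\<Sum>j<p. int_eval z (N j) * t j)
        \<le> (\<Sum>j<p. cmod (int_eval z (N j)) * (\<delta> / (cmod z - 1) / cmod z ^ L))"
      using S[OF _ z] unfolding t_def[symmetric]
      by (intro order_trans[OF norm_sum] sum_mono) (simp only: norm_mult lessThan_iff mult_left_mono norm_ge_zero)
    also have "\<dots> = K * (1 / cmod z) ^ L"
      unfolding K_def sum_distrib_right[symmetric] by (simp add: power_divide)
    finally show ?thesis by (simp add: power_divide add.commute)
  qed
  have "(\<lambda>L. K * (1 / cmod z) ^ L + cmod (int_eval z D) * (1 / \<delta>) ^ L)
      \<longlonglongrightarrow> K * 0 + cmod (int_eval z D) * 0"
    using z delta_gt_1 by (intro tendsto_intros LIMSEQ_power_zero) (auto simp: divide_simps)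
  then have "e \<le> K * 0 + cmod (int_eval z D) * 0"
    by (rule LIMSEQ_le_const) (use bound in \<open>auto intro!: exI[of _ 1]\<close>)
  then have "1 / z - 1 / \<delta>\<^sub>c = 0" using Dz by (simp add: e_def)
  then show ?thesis by simp
qed

text \<open>For transcendental \<delta> only the zero polynomial vanishes there, so every
  \<open>z\<close> satisfies the transfer hypothesis; a real \<open>z > \<delta>\<close> avoiding
  the finitely many roots of \<open>D\<close> is then a contradiction.\<close>

lemma delta_algebraic: "\<exists>T. T \<noteq> 0 \<and> int_eval \<delta>\<^sub>c T = 0"
proof (rule ccontr)
  assume "\<nexists>T. T \<noteq> 0 \<and> int_eval \<delta>\<^sub>c T = 0"
  then have trans: "int_eval \<delta>\<^sub>c T = 0 \<Longrightarrow> T = 0" for T by blast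
  obtain D N where D: "int_eval \<delta>\<^sub>c D \<noteq> 0"
    and N: "\<And>j. j < p \<Longrightarrow> int_eval \<delta>\<^sub>c (N j) = of_real (suffix_prod (Suc j)) * int_eval \<delta>\<^sub>c D"
    using suffix_prods_in_field by metis
  have "map_poly of_int D \<noteq> (0 :: complex poly)" using D by (auto simp: int_eval_def)
  then have "finite {z. int_eval z D = 0}" unfolding int_eval_def by (rule poly_roots_finite)
  moreover have "infinite (complex_of_real ` {\<delta><..})"
    by (subst finite_image_iff) (auto simp: inj_on_def infinite_Ioi)
  ultimately obtain z where "z \<in> complex_of_real ` {\<delta><..}" and Dz: "int_eval z D \<noteq> 0"
    by (metis (mono_tags, lifting) finite_subset mem_Collect_eq subsetI)
  then obtain t where t: "z = of_real t" "t > \<delta>" by auto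
  have "z = \<delta>\<^sub>c"
    using D N _ _ Dz
  proof (rule conjugate_outside_disc)
    show "int_eval z T = 0" if "int_eval \<delta>\<^sub>c T = 0" for T using trans[OF that] by simp
  qed (use t delta_gt_1 in auto)
  then show False using t by simp
qed

text \<open>A nonzero integer does not vanish at \<delta>, which leaves only the divisibility
  alternative for the vanishing ideal, directly over the integers.\<close>

lemma minimal_polynomial:
  obtains P where "irreducible P" "degree P > 0" "\<And>T. int_eval \<delta>\<^sub>c T = 0 \<longleftrightarrow> P dvd T"
proof -
  obtain P where P: "irreducible P" "int_eval \<delta>\<^sub>c P = 0"
    using delta_algebraic irreducible_root_factor by blast
  have const: "c = 0" if "int_eval \<delta>\<^sub>c [:c:] = 0" for c using that by simp
  have "degree P > 0"
  proof (rule ccontr)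
    assume "\<not> degree P > 0"
    then obtain c where c: "P = [:c:]" using degree_eq_zeroE[of P] by auto
    then show False using P const[of c] by auto
  qed
  moreover have "P dvd T" if "int_eval \<delta>\<^sub>c T = 0" for T
    using ideal_of_int_poly_irreducible[OF P(1), of "{T. int_eval \<delta>\<^sub>c T = 0}"] P(2) that const
    by (auto simp: int_eval.hom_mult int_eval.hom_minus)
  moreover have "int_eval \<delta>\<^sub>c T = 0" if "P dvd T" for T
    using that P(2) by (auto simp: int_eval.hom_mult)
  ultimately show thesis using that[of P] P(1) by blast
qed

section \<open>Integrality\<close>

text \<open>Here \<open>r\<close> times each suffix product is an integer polynomial in \<delta>.
  The expansion of \<open>1 / b\<close> with many leading zero blocks gives a multiple
  \<open>F\<close> of \<open>P\<close> whose top coefficients are those of \<open>r\<close> times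
  the difference of the monomials of degree \<open>m + q\<close> and \<open>m\<close>.\<close>

lemma minimal_polynomial_lead_coeff:
  assumes P: "irreducible P" "degree P > 0" "\<And>T. int_eval \<delta>\<^sub>c T = 0 \<longleftrightarrow> P dvd T"
    and r: "r \<noteq> 0"
    and N: "\<And>j. j < p \<Longrightarrow> int_eval \<delta>\<^sub>c (N j) = of_real (suffix_prod (Suc j)) * of_int r"
  shows "\<bar>lead_coeff P\<bar> = 1"
proof (rule irreducible_lead_coeff_unit[OF P(1,2) r])
  fix n
  \<comment> \<open>The \<open>K\<close> extra zero blocks compensate for the degrees of the
    \<open>N j\<close>, so that \<open>n\<close> coefficients remain controlled.\<close>
  define K where "K = (\<Sum>j<p. degree (N j))"
  define n0 where "n0 = n + K"
  have K: "degree (N j) \<le> K" if "j < p" for j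
    unfolding K_def using that by (intro member_le_sum) auto
  obtain b :: nat where b: "\<delta> ^ n0 < of_nat b" using reals_Archimedean2 by blast
  have "\<delta> ^ n0 \<ge> 1" using delta_gt_1 by (simp add: less_imp_le)
  with b have b1: "b > 1" by linarith
  define x :: real where "x = 1 / of_nat b"
  have x: "x \<in> \<rat>" "0 \<le> x" "x < 1" using b1 by (auto simp: x_def)
  have "prefix_prod (n0 * p) * x < 1"
    using b b1 by (simp add: prefix_prod_block x_def)
  note zero = greedy_leading_zeros(2)[OF x(2) this]
  obtain m q B where q: "q > n0" and dB: "\<And>j. j < p \<Longrightarrow> degree (B j) \<le> m + q - 1 - n0"
    and B: "\<And>j w. j < p \<Longrightarrow> cmod w > 1 \<Longrightarrow> digit_series x j w * (w ^ m * (w ^ q - 1)) = int_eval w (B j)"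
    using digit_series_rational_function[OF x, of n0] zero by metis
  define E where "E = [:int b:] * (\<Sum>j<p. N j * B j)"
  \<comment> \<open>\<open>F\<close> vanishes at \<delta> because \<open>b * x = 1\<close>, and
    \<open>E\<close> is too small in degree to affect its top \<open>n\<close> coefficients.\<close>
  define F where "F = [:r:] * (monom 1 (m + q) - monom 1 m) - E"
  have "degree (N j * B j) \<le> m + q - 1 - n" if "j < p" for j
    using degree_mult_le[of "N j" "B j"] K[OF that] dB[OF that] q by (simp add: n0_def)
  then have "degree (\<Sum>j<p. N j * B j) \<le> m + q - 1 - n" by (intro degree_sum_le) auto
  then have "degree E \<le> m + q - 1 - n"
    unfolding E_def by (simp add: order_trans[OF degree_smult_le])
  then have E: "coeff E k = 0" if "k > m + q - 1 - n" for k
    using that by (intro coeff_eq_0) simp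
  have coeffF: "coeff F k = r * coeff (monom 1 (m + q) - monom 1 m) k" if "k > m + q - 1 - n" for k
    using E[OF that] by (simp add: F_def)
  have top: "coeff F (m + q) = r" using q by (subst coeffF) auto
  have "degree F \<le> m + q"
  proof (rule degree_le, intro allI impI)
    fix k assume "k > m + q"
    then show "coeff F k = 0" by (subst coeffF) auto
  qed
  moreover have "degree F \<ge> m + q" using top r by (intro le_degree) simp
  ultimately have deg: "degree F = m + q" by simp
  have "int_eval \<delta>\<^sub>c F = of_int r * (\<delta>\<^sub>c ^ m * (\<delta>\<^sub>c ^ q - 1))
      - of_nat b * (\<Sum>j<p. int_eval \<delta>\<^sub>c (N j) * int_eval \<delta>\<^sub>c (B j))"
    unfolding F_def E_def int_eval.hom_mult int_eval.hom_minus int_eval.hom_sum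
      int_eval_const int_eval_monom power_add
    by (simp add: right_diff_distrib)
  also have "(\<Sum>j<p. int_eval \<delta>\<^sub>c (N j) * int_eval \<delta>\<^sub>c (B j))
      = of_int r * (\<delta>\<^sub>c ^ m * (\<delta>\<^sub>c ^ q - 1)) *
        (\<Sum>j<p. of_real (suffix_prod (Suc j)) * digit_series x j \<delta>\<^sub>c)"
    unfolding sum_distrib_left using N B[OF _ norm_delta, symmetric]
    by (intro sum.cong) (simp_all add: mult_ac)
  also have "(\<Sum>j<p. of_real (suffix_prod (Suc j)) * digit_series x j \<delta>\<^sub>c) = of_real x"
    using expansion[OF x(2,3)] by simp
  finally have "int_eval \<delta>\<^sub>c F = 0" using b1 by (simp add: x_def)
  then have "P dvd F" by (simp add: P(3))
  moreover have "r dvd coeff (reflect_poly F) k" if "k < n" for k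
  proof (cases "k > m + q")
    case False
    have "m + q - k > m + q - 1 - n" using that False q by (simp add: n0_def)
    then show ?thesis using False by (simp add: coeff_reflect_poly deg coeffF)
  qed (simp add: coeff_reflect_poly deg)
  ultimately show "\<exists>F. P dvd F \<and> lead_coeff F = r \<and> (\<forall>k<n. r dvd coeff (reflect_poly F) k)"
    using top deg by (intro exI[of _ F]) auto
qed

section \<open>Conclusions for \<delta> and the bases\<close>

lemma delta_pisot_or_salem: "pisot \<delta> \<or> salem \<delta>"
proof -
  obtain P where P: "irreducible P" "degree P > 0" "\<And>T. int_eval \<delta>\<^sub>c T = 0 \<longleftrightarrow> P dvd T"
    using minimal_polynomial by metis
  obtain D N where D: "int_eval \<delta>\<^sub>c D \<noteq> 0"
    and N: "\<And>j. j < p \<Longrightarrow> int_eval \<delta>\<^sub>c (N j) = of_real (suffix_prod (Suc j)) * int_eval \<delta>\<^sub>c D"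
    using suffix_prods_in_field by metis
  \<comment> \<open>\<open>P\<close> does not divide \<open>D\<close>, so this ideal contains a
    nonzero integer \<open>r\<close>. The Bezout relation makes \<open>T * N j\<close> the
    numerators over \<open>r\<close> needed for integrality, and shows that \<open>D\<close> has no
    root in common with \<open>P\<close>.\<close>
  define I where "I = {S * P + T * D |S T. True}"
  have I: "S * P + T * D \<in> I" for S T unfolding I_def by blast
  have closed: "smult a f - g * q \<in> I" if f: "f \<in> I" and g: "g \<in> I" for f g q a
  proof -
    obtain S T where fST: "f = S * P + T * D" using f unfolding I_def by blast
    obtain S' T' where gST: "g = S' * P + T' * D" using g unfolding I_def by blast
    have "smult a f - g * q = (smult a S - S' * q) * P + (smult a T - T' * q) * D"
      unfolding fST gST by (simp add: algebra_simps smult_add_right)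
    then show ?thesis using I by simp
  qed
  have "P \<in> I" "D \<in> I" using I[of 1 0] I[of 0 1] by simp_all
  then obtain r where "r \<noteq> 0" "[:r:] \<in> I"
    using ideal_of_int_poly_irreducible[OF P(1) _ closed] D P(3) by blast
  then obtain S T where r: "r \<noteq> 0" "[:r:] = S * P + T * D" unfolding I_def by blast
  have bezout: "of_int r = int_eval z S * int_eval z P + int_eval z T * int_eval z D" for z
    using arg_cong[OF r(2), of "int_eval z"] by (simp add: int_eval.hom_add int_eval.hom_mult)
  have Pd: "int_eval \<delta>\<^sub>c P = 0" by (simp add: P(3))
  have "int_eval \<delta>\<^sub>c (T * N j) = of_real (suffix_prod (Suc j)) * of_int r" if "j < p" for j
    using bezout[of \<delta>\<^sub>c] N[OF that] Pd by (simp add: int_eval.hom_mult)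
  then have lead: "\<bar>lead_coeff P\<bar> = 1"
    by (rule minimal_polynomial_lead_coeff[OF P r(1)])
  have conj: "cmod z \<le> 1" if z: "int_eval z P = 0" "z \<noteq> \<delta>\<^sub>c" for z
  proof (rule ccontr)
    assume "\<not> cmod z \<le> 1"
    moreover have "int_eval z T = 0" if "int_eval \<delta>\<^sub>c T = 0" for T
      using that z(1) by (auto simp: P(3) int_eval.hom_mult)
    moreover have "int_eval z D \<noteq> 0" using bezout[of z] r(1) z(1) by auto
    ultimately have "z = \<delta>\<^sub>c" by (intro conjugate_outside_disc[OF D N]) auto
    with z(2) show False by simp
  qed
  \<comment> \<open>The leading coefficient is 1 or -1, so this normalises the sign and makes the
    polynomial monic.\<close>
  define M where "M = [:lead_coeff P:] * P"
  have unit: "lead_coeff P * lead_coeff P = 1" using lead by (auto simp: abs_if split: if_splits)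
  then have "is_unit [:lead_coeff P:]" by (metis dvd_triv_left is_unit_const_poly_iff)
  then have M: "irreducible M" using P(1) unfolding M_def by (simp only: irreducible_mult_unit_left)
  have lM: "lead_coeff M = 1" unfolding M_def lead_coeff_mult using unit by simp
  have root: "poly (map_poly of_int M) z = 0 \<longleftrightarrow> int_eval z P = 0" for z
  proof -
    have "int_eval z M = of_int (lead_coeff P) * int_eval z P"
      unfolding M_def by (simp only: int_eval.hom_mult int_eval_const)
    moreover have "lead_coeff P \<noteq> 0" using lead by linarith
    ultimately show ?thesis by (simp add: int_eval_def)
  qed
  show ?thesis
  proof (cases "\<exists>z. int_eval z P = 0 \<and> z \<noteq> \<delta>\<^sub>c \<and> cmod z = 1")
    case True
    then have "salem \<delta>"
      unfolding salem_def using delta_gt_1 M lM conj Pd by (intro conjI exI[of _ M]) (simp_all add: root)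
    then show ?thesis ..
  next
    case False
    then have "pisot \<delta>"
      unfolding pisot_def using delta_gt_1 M lM conj Pd
      by (intro conjI exI[of _ M]) (auto simp: root less_le)
    then show ?thesis ..
  qed
qed

text \<open>Each base is a quotient of two consecutive suffix products, and the common denominator
  \<open>D\<close> cancels.\<close>

lemma bases_in_Q_adjoin:
  assumes "b \<in> set bs"
  shows "in_Q_adjoin \<delta> b"
proof -
  obtain D N where D: "int_eval \<delta>\<^sub>c D \<noteq> 0"
    and N: "\<And>j. j < p \<Longrightarrow> int_eval \<delta>\<^sub>c (N j) = of_real (suffix_prod (Suc j)) * int_eval \<delta>\<^sub>c D"
    using suffix_prods_in_field by metis
  obtain i where i: "i < p" "b = bs ! i" using assms by (metis in_set_conv_nth)
  obtain G where G: "int_eval \<delta>\<^sub>c G = of_real (suffix_prod i) * int_eval \<delta>\<^sub>c D"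
  proof (cases i)
    case 0
    \<comment> \<open>\<open>suffix_prod 0\<close> is \<delta> itself and not among the
      \<open>N j\<close>, so its numerator is the variable times \<open>D\<close>.\<close>
    have "int_eval \<delta>\<^sub>c (monom 1 1 * D) = of_real (suffix_prod i) * int_eval \<delta>\<^sub>c D"
      by (simp add: int_eval.hom_mult 0 suffix_prod_0)
    then show ?thesis by (rule that)
  next
    case (Suc j)
    then show ?thesis using N[of j] i(1) by (intro that[of "N j"]) simp
  qed
  have "suffix_prod (Suc i) \<noteq> 0" using suffix_prod_ge_1[of "Suc i"] by simp
  then have "int_eval \<delta>\<^sub>c (N i) \<noteq> 0" using N[OF i(1)] D by simp
  moreover have "of_real b * int_eval \<delta>\<^sub>c (N i) = int_eval \<delta>\<^sub>c G"
    using N[OF i(1)] by (simp add: G i(2) suffix_prod_Suc[OF i(1)])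
  ultimately show ?thesis by (rule in_Q_adjoin_of_int_polys)
qed

end

theorem theoremA:
  fixes bs :: "real list"
  assumes "alt_base bs"
    and "\<forall>x \<in> \<rat>. 0 \<le> x \<and> x < 1 \<longrightarrow> x \<in> Per bs"
  shows "(pisot (prod_list bs) \<or> salem (prod_list bs)) \<and>
         (\<forall>b \<in> set bs. in_Q_adjoin (prod_list bs) b)"
proof -
  interpret rational_periodic_base bs
    by unfold_locales (use assms in auto)
  show ?thesis using delta_pisot_or_salem bases_in_Q_adjoin by blast
qed

end
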